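(* Let $m\ge1$ and for $j,k\in\mathbb{N}$ let $c(j,k)$ be the coefficient of $q^jt^k$ in $C^{(m)}_4(q,t)$. For real $a$ put $\lfloor a\rfloor^+=\max(\lfloor a\rfloor,0)$. (a) If $j+k>4m$, then $c(j,k)=\min\left(\lfloor\frac{-6m+2+3j+k}{2}\rfloor^+,\ \lfloor\frac{6m+2-j-k}{2}\rfloor^+,\ \lfloor\frac{-6m+2+j+3k}{2}\rfloor^+\right)$. (b) If $j+k=4m$, then $c(j,k)=\min\left(\lfloor\frac{-m+2+j}{2}\rfloor^+,\ \lfloor\frac{-m+2+k}{2}\rfloor^+\right)$. (c) If $j+k<4m$, then $c(j,k)=0$. Consequently, for every positive integer $d$ the sequence $(c(d,0),c(d-1,1),\dots,c(1,d-1),c(0,d))$ is unimodal.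
   Context: An $m$-Dyck word of length $4$ is a sequence $\gamma=(\gamma_0,\gamma_1,\gamma_2,\gamma_3)$ of nonnegative integers with $\gamma_0=0$ and $\gamma_i\le\gamma_{i-1}+m$ for $i=1,2,3$; $W^{(m)}_4$ is the set of these. $\mathrm{area}(\gamma)=\sum_i\gamma_i$, $\mathrm{dinv}_m(\gamma)=\sum_{0\le i<j\le3}\mathrm{sc}_m(\gamma_i-\gamma_j)$ where $\mathrm{sc}_m(p)=m+1-p$ if $1\le p\le m$, $\mathrm{sc}_m(p)=m+p$ if $-m\le p\le 0$, and $0$ otherwise. $C^{(m)}_4(q,t)=\sum_{\gamma\in W^{(m)}_4}q^{\mathrm{area}(\gamma)}t^{\mathrm{dinv}_m(\gamma)}$. *)

theory Defs
  imports Complex_Main "HOL-Computational_Algebra.Polynomial"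
begin

text \<open>A word is the list of its four letters, so \<^term>\<open>g ! i\<close> is the letter with index \<open>i\<close>.\<close>

definition dyck_words4 :: "nat \<Rightarrow> nat list set" where
  "dyck_words4 m =
     {g. length g = 4 \<and> g ! 0 = 0 \<and> (\<forall>i\<in>{1..3}. g ! i \<le> g ! (i - 1) + m)}"

definition area :: "nat list \<Rightarrow> nat" where
  "area g = sum_list g"

definition sc :: "nat \<Rightarrow> int \<Rightarrow> nat" where
  "sc m p =
     (if 1 \<le> p \<and> p \<le> int m then nat (int m + 1 - p)
      else if - int m \<le> p \<and> p \<le> 0 then nat (int m + p)
      else 0)"

definition dinv :: "nat \<Rightarrow> nat list \<Rightarrow> nat" where
  "dinv m g = (\<Sum>j\<in>{0..3}. \<Sum>i\<in>{0..<j}. sc m (int (g ! i) - int (g ! j)))"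

text \<open>The sum defining \<open>cat4\<close> below ranges over a finite set.\<close>

lemma finite_dyck_words4: "finite (dyck_words4 m)"
proof (rule finite_subset)
  show "dyck_words4 m \<subseteq> {g. set g \<subseteq> {..3 * m} \<and> length g = 4}"
  proof
    fix g assume g: "g \<in> dyck_words4 m"
    then have len: "length g = 4" and zero: "g ! 0 = 0"
      and le: "\<And>i. i \<in> {1..3} \<Longrightarrow> g ! i \<le> g ! (i - 1) + m"
      by (auto simp: dyck_words4_def)
    have step: "g ! 0 = 0" "g ! 1 \<le> g ! 0 + m" "g ! 2 \<le> g ! 1 + m" "g ! 3 \<le> g ! 2 + m"
      using zero le[of 1] le[of 2] le[of 3] by simp_all
    have "g ! i \<le> 3 * m" if "i < 4" for i
    proof -
      have "i = 0 \<or> i = 1 \<or> i = 2 \<or> i = 3" using that by arith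
      then show ?thesis using step by auto
    qed
    then show "g \<in> {g. set g \<subseteq> {..3 * m} \<and> length g = 4}"
      using len by (auto simp: in_set_conv_nth)
  qed
  show "finite {g. set g \<subseteq> {..3 * m} \<and> length g = 4}"
    by (rule finite_lists_length_eq) simp
qed

text \<open>Polynomials in \<open>q\<close> and \<open>t\<close> are polynomials in the outer variable \<open>t\<close> whose
  coefficients are polynomials in the inner variable \<open>q\<close>; hence \<open>monom (monom 1 j) k\<close>
  is the monomial with \<open>q\<close>-exponent \<open>j\<close> and \<open>t\<close>-exponent \<open>k\<close>.\<close>

definition cat4 :: "nat \<Rightarrow> int poly poly" where
  "cat4 m = (\<Sum>g\<in>dyck_words4 m. monom (monom 1 (area g)) (dinv m g))"

definition cat4_coeff :: "nat \<Rightarrow> nat \<Rightarrow> nat \<Rightarrow> int" where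
  "cat4_coeff m j k = coeff (coeff (cat4 m) k) j"

definition floor_pos :: "real \<Rightarrow> int" where
  "floor_pos a = max \<lfloor>a\<rfloor> 0"

text \<open>The peak is an index of the list, so the empty list is not unimodal.\<close>

definition unimodal :: "int list \<Rightarrow> bool" where
  "unimodal xs \<longleftrightarrow>
     (\<exists>p<length xs. (\<forall>i j. i \<le> j \<and> j \<le> p \<longrightarrow> xs ! i \<le> xs ! j) \<and>
                    (\<forall>i j. p \<le> i \<and> i \<le> j \<and> j < length xs \<longrightarrow> xs ! i \<ge> xs ! j))"

end

(* A word (0, a, b, c) with a <= m is treated as a triple of integers with codegree
   e = 6m - area - dinv, so that c(j, k) is the number N(e, j) of words with e = 6m - j - k
   and area j.  Raising the last letter by one and then sorting it into an earlier place,

     (a, b, c) -> (c+1, a, b)  if c < m,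
                  (a, c+1, b)  if m <= c < a+m,
                  (a, b, c+1)  if a+m <= c < b+m,

   preserves e and raises the area by one.  Each branch is injective.  The map is undefined
   exactly when a <= b and c = b+m; it misses exactly the words (x, y, z) with x = 0, z <= m and
   those with y >= z+m+2; two branches hit the same word exactly when x >= 1, y <= m and z > x+m.
   Each of these exceptional families is governed by one parameter, hence counted by hand, which
   gives the difference N(e, j+1) - N(e, j); the formula follows by induction on j. *)
theory Submission
  imports Defs
begin

section \<open>Words as integer triples and the shift map\<close>

text \<open>The shortfall of \<open>sc m p\<close> from its largest value \<open>m\<close>. The
  identity \<open>gap m p = gap m (1 - p)\<close> is what allows a letter raised by one to jump over
  an earlier letter.\<close>

definition gap :: "int \<Rightarrow> int \<Rightarrow> int" where
  "gap m p = min m (if p > 0 then p - 1 else - p)"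

text \<open>
  For a word \<open>(0, a, b, c)\<close> with \<open>a \<le> m\<close> this is \<open>6 * m - area - dinv\<close>: the pairs
  containing the leading letter contribute \<open>a + min m b + min m c\<close>, from which the area is subtracted.
\<close>

definition codeg :: "int \<Rightarrow> int \<Rightarrow> int \<Rightarrow> int \<Rightarrow> int" where
  "codeg m a b c =
     gap m (a - b) + gap m (a - c) + gap m (b - c) - max 0 (b - m) - max 0 (c - m)"

definition words :: "int \<Rightarrow> int \<Rightarrow> int \<Rightarrow> (int \<times> int \<times> int) set" where
  "words m e j = {(a, b, c). 0 \<le> a \<and> a \<le> m \<and> 0 \<le> b \<and> b \<le> a + m \<and> 0 \<le> c \<and> c \<le> b + m \<and>
     a + b + c = j \<and> codeg m a b c = e}"

lemma finite_words [simp]: "finite (words m e j)"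
  by (rule finite_subset[of _ "{0..m} \<times> {0..2*m} \<times> {0..3*m}"]) (auto simp: words_def)

text \<open>Moving \<open>c + 1\<close> to the front permutes the three gaps, by
  \<open>gap m p = gap m (1 - p)\<close>. As \<open>a\<close> and \<open>c\<close> do not exceed
  \<open>m\<close>, only \<open>b\<close> can carry a correction term on either side.\<close>

lemma codeg_shift1:
  assumes "0 \<le> a" "a \<le> m" "0 \<le> b" "b \<le> a + m" "0 \<le> c" "c < m"
  shows "codeg m (c + 1) a b = codeg m a b c"
  using assms unfolding codeg_def gap_def by (auto simp: min_def max_def)

text \<open>Jumping over \<open>b\<close> keeps their gap. The gap \<open>c - a < m\<close> grows by
  one, and so does the subtracted \<open>max 0 (c - m)\<close>.\<close>

lemma codeg_shift2:
  assumes "0 \<le> a" "a \<le> m" "0 \<le> b" "b \<le> a + m" "m \<le> c" "c < a + m" "c \<le> b + m"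
  shows "codeg m a (c + 1) b = codeg m a b c"
  using assms unfolding codeg_def gap_def by (auto simp: min_def max_def)

text \<open>The gap to \<open>a\<close> is saturated at \<open>m\<close>; the gap
  \<open>c - b < m\<close> grows by one together with the subtracted
  \<open>max 0 (c - m)\<close>.\<close>

lemma codeg_shift3:
  assumes "0 \<le> a" "a \<le> m" "0 \<le> b" "b \<le> a + m" "a + m \<le> c" "c < b + m"
  shows "codeg m a b (c + 1) = codeg m a b c"
  using assms unfolding codeg_def gap_def by (auto simp: min_def max_def)

lemma words_step:
  assumes "m \<ge> 0"
  shows "int (card (words m e (j + 1))) - int (card (words m e j)) =
    int (card {(x, y, z) \<in> words m e (j + 1). x = 0 \<and> z \<le> m}) +
    int (card {(x, y, z) \<in> words m e (j + 1). y \<ge> z + m + 2}) -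
    int (card {(x, y, z) \<in> words m e (j + 1). x \<ge> 1 \<and> y \<le> m \<and> z > x + m}) -
    int (card {(a, b, c) \<in> words m e j. a \<le> b \<and> c = b + m})"
proof -
  \<comment> \<open>\<open>D1\<close>, \<open>D2\<close>, \<open>D3\<close> are the domains of the
    three branches, \<open>I1\<close>, \<open>I2\<close>, \<open>I3\<close> their images;
    \<open>U\<close> is where no branch applies, \<open>M1\<close> and \<open>M2\<close> are missed,
    \<open>K\<close> is hit twice.\<close>
  define D1 where "D1 = {(a, b, c) \<in> words m e j. c < m}"
  define D2 where "D2 = {(a, b, c) \<in> words m e j. m \<le> c \<and> c < a + m}"
  define D3 where "D3 = {(a, b, c) \<in> words m e j. a + m \<le> c \<and> c < b + m}"
  define U where "U = {(a, b, c) \<in> words m e j. a \<le> b \<and> c = b + m}"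
  define I1 where "I1 = {(x, y, z) \<in> words m e (j + 1). x \<ge> 1 \<and> y \<le> m}"
  \<comment> \<open>The bound \<open>y \<le> z + m + 1\<close> makes the preimage
    \<open>(x, z, y - 1)\<close> a word.\<close>
  define I2 where "I2 = {(x, y, z) \<in> words m e (j + 1). y > m \<and> z \<le> x + m \<and> y \<le> z + m + 1}"
  define I3 where "I3 = {(x, y, z) \<in> words m e (j + 1). z > x + m}"
  define M1 where "M1 = {(x, y, z) \<in> words m e (j + 1). x = 0 \<and> z \<le> m}"
  define M2 where "M2 = {(x, y, z) \<in> words m e (j + 1). y \<ge> z + m + 2}"
  define K where "K = {(x, y, z) \<in> words m e (j + 1). x \<ge> 1 \<and> y \<le> m \<and> z > x + m}"
  note defs = D1_def D2_def D3_def U_def I1_def I2_def I3_def M1_def M2_def K_def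
  have fin: "finite D1" "finite D2" "finite D3" "finite U" "finite I1" "finite I2"
    "finite I3" "finite M1" "finite M2" "finite K"
    unfolding defs by (rule finite_subset[OF _ finite_words], auto)+
  have "bij_betw (\<lambda>(a, b, c). (c + 1, a, b)) D1 I1"
  proof (rule bij_betw_byWitness[where f' = "\<lambda>(x, y, z). (y, z, x - 1)"])
    show "(\<lambda>(a, b, c). (c + 1, a, b)) ` D1 \<subseteq> I1"
      by (auto simp: D1_def I1_def words_def codeg_shift1)
    have "codeg m y z (x - 1) = codeg m x y z" if "(x, y, z) \<in> I1" for x y z
      using codeg_shift1[of y m z "x - 1"] that by (simp add: I1_def words_def)
    then show "(\<lambda>(x, y, z). (y, z, x - 1)) ` I1 \<subseteq> D1"
      by (auto simp: D1_def I1_def words_def)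
  qed auto
  moreover have "bij_betw (\<lambda>(a, b, c). (a, c + 1, b)) D2 I2"
  proof (rule bij_betw_byWitness[where f' = "\<lambda>(x, y, z). (x, z, y - 1)"])
    show "(\<lambda>(a, b, c). (a, c + 1, b)) ` D2 \<subseteq> I2"
      by (auto simp: D2_def I2_def words_def codeg_shift2)
    have "codeg m x z (y - 1) = codeg m x y z" if "(x, y, z) \<in> I2" for x y z
      using codeg_shift2[of x m z "y - 1"] that by (simp add: I2_def words_def)
    then show "(\<lambda>(x, y, z). (x, z, y - 1)) ` I2 \<subseteq> D2"
      by (auto simp: D2_def I2_def words_def)
  qed auto
  moreover have "bij_betw (\<lambda>(a, b, c). (a, b, c + 1)) D3 I3"
  proof (rule bij_betw_byWitness[where f' = "\<lambda>(x, y, z). (x, y, z - 1)"])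
    show "(\<lambda>(a, b, c). (a, b, c + 1)) ` D3 \<subseteq> I3"
      by (auto simp: D3_def I3_def words_def codeg_shift3)
    have "codeg m x y (z - 1) = codeg m x y z" if "(x, y, z) \<in> I3" for x y z
      using codeg_shift3[of x m y "z - 1"] that by (simp add: I3_def words_def)
    then show "(\<lambda>(x, y, z). (x, y, z - 1)) ` I3 \<subseteq> D3"
      by (auto simp: D3_def I3_def words_def)
  qed auto
  ultimately have D: "card D1 = card I1" "card D2 = card I2" "card D3 = card I3"
    by (auto dest: bij_betw_same_card)
  have "words m e j = ((D1 \<union> D2) \<union> D3) \<union> U"
    unfolding defs by (auto simp: words_def)
  moreover have "D1 \<inter> D2 = {}" "(D1 \<union> D2) \<inter> D3 = {}" "((D1 \<union> D2) \<union> D3) \<inter> U = {}"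
    unfolding defs using assms by (auto simp: words_def)
  ultimately have j: "card (words m e j) = card D1 + card D2 + card D3 + card U"
    using fin by (simp add: card_Un_disjoint)
  have "words m e (j + 1) = ((I1 \<union> I3) \<union> I2) \<union> M1 \<union> M2"
    unfolding defs using assms by (auto simp: words_def)
  moreover have "I1 \<inter> I3 = K" "(I1 \<union> I3) \<inter> I2 = {}" "(I1 \<union> I3 \<union> I2) \<inter> M1 = {}"
    "(I1 \<union> I3 \<union> I2 \<union> M1) \<inter> M2 = {}"
    unfolding defs using assms by (auto simp: words_def)
  moreover have "card (I1 \<union> I3) + card (I1 \<inter> I3) = card I1 + card I3"
    using fin card_Un_Int[of I1 I3] by simp
  ultimately have "card (words m e (j + 1)) + card K = card I1 + card I2 + card I3 + card M1 + card M2"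
    using fin by (simp add: card_Un_disjoint)
  with j D show ?thesis by (simp flip: M1_def M2_def K_def U_def)
qed

section \<open>Sizes of the exceptional families\<close>

text \<open>With \<open>x = 0\<close> the codegree is \<open>2 * z\<close> if
  \<open>y \<le> z\<close> and \<open>2 * y - 1\<close> otherwise. So the parity of \<open>e\<close>
  tells which letter is maximal, \<open>e\<close> gives its value and the area gives the other
  one.\<close>

lemma card_initial_zero:
  assumes "m \<ge> 0"
  shows "int (card {(x, y, z) \<in> words m e j. x = 0 \<and> z \<le> m}) =
    (if (e + 1) div 2 \<le> j \<and> j \<le> e \<and> e \<le> 2 * m then 1 else 0)"
proof -
  have "{(x, y, z) \<in> words m e j. x = 0 \<and> z \<le> m} =
    (if (e + 1) div 2 \<le> j \<and> j \<le> e \<and> e \<le> 2 * m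
     then {if even e then (0, j - e div 2, e div 2) else (0, (e + 1) div 2, j - (e + 1) div 2)}
     else {})" (is "?L = ?R")
  proof (rule set_eqI)
    fix v show "v \<in> ?L \<longleftrightarrow> v \<in> ?R"
    proof (cases v)
      case (fields x y z)
      show ?thesis
      proof (cases "even e")
        case True
        then obtain f where "e = 2 * f" by blast
        then show ?thesis using assms fields
          by (auto simp: words_def codeg_def gap_def min_def max_def; presburger)
      next
        case False
        then obtain f where "e = 2 * f + 1" by (elim oddE)
        then show ?thesis using assms fields
          by (auto simp: words_def codeg_def gap_def min_def max_def; presburger)
      qed
    qed
  qed
  then show ?thesis by simp
qed

lemma card_image_atLeastAtMost_int:
  fixes l u :: int
  assumes "inj f"
  shows "int (card (f ` {l..u})) = max 0 (u - l + 1)"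
  using card_image[OF inj_on_subset[OF assms subset_UNIV], of "{l..u}"] by auto

text \<open>The codegree collapses to \<open>2 * m - 1 - z\<close>, which forces
  \<open>z = s - 1\<close> and leaves \<open>y\<close> free. The lower bounds on \<open>y\<close>
  come from the descent and from \<open>x \<le> m\<close>, the upper one from
  \<open>y \<le> x + m\<close>.\<close>

lemma card_descent_second:
  assumes "m \<ge> 0"
  shows "int (card {(x, y, z) \<in> words m (2 * m - s) j. y \<ge> z + m + 2}) =
    (if s \<ge> 1 then max 0 ((j - s + 1 + m) div 2 - max (s + m + 1) (j - s + 1 - m) + 1) else 0)"
proof -
  have "{(x, y, z) \<in> words m (2 * m - s) j. y \<ge> z + m + 2} =
    (if s \<ge> 1 then (\<lambda>y. (j - s + 1 - y, y, s - 1)) `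
       {max (s + m + 1) (j - s + 1 - m)..(j - s + 1 + m) div 2} else {})" (is "?L = ?R")
  proof (rule set_eqI)
    fix v show "v \<in> ?L \<longleftrightarrow> v \<in> ?R"
    proof (cases v)
      case (fields x y z)
      show ?thesis using assms fields
        by (auto simp: words_def codeg_def gap_def min_def max_def image_iff split: if_splits)
    qed
  qed
  moreover have inj: "inj (\<lambda>y. (j - s + 1 - y, y, s - 1))" by (auto intro: injI)
  ultimately show ?thesis by (simp add: card_image_atLeastAtMost_int[OF inj])
qed

text \<open>The codegree collapses to \<open>2 * m - x\<close>, which forces \<open>x = s\<close>
  and leaves \<open>y\<close> free. Below, \<open>y\<close> is bounded by \<open>x < y\<close> and
  by \<open>z \<le> y + m\<close>; above, by \<open>y \<le> m\<close> and
  \<open>z > x + m\<close>.\<close>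

lemma card_shift_collisions:
  assumes "m \<ge> 0"
  shows "int (card {(x, y, z) \<in> words m (2 * m - s) j. x \<ge> 1 \<and> y \<le> m \<and> z > x + m}) =
    (if s \<ge> 1 then max 0 (min m (j - 2 * s - m - 1) - max (s + 1) ((j - s - m + 1) div 2) + 1) else 0)"
proof -
  have "{(x, y, z) \<in> words m (2 * m - s) j. x \<ge> 1 \<and> y \<le> m \<and> z > x + m} =
    (if s \<ge> 1 then (\<lambda>y. (s, y, j - s - y)) `
       {max (s + 1) ((j - s - m + 1) div 2)..min m (j - 2 * s - m - 1)} else {})" (is "?L = ?R")
  proof (rule set_eqI)
    fix v show "v \<in> ?L \<longleftrightarrow> v \<in> ?R"
    proof (cases v)
      case (fields x y z)
      show ?thesis using assms fields
        by (auto simp: words_def codeg_def gap_def min_def max_def image_iff split: if_splits)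
    qed
  qed
  moreover have inj: "inj (\<lambda>y. (s, y, j - s - y))" by (auto intro: injI)
  ultimately show ?thesis by (simp add: card_image_atLeastAtMost_int[OF inj])
qed

text \<open>The codegree is \<open>2 * m - a - max 0 (b - m)\<close>. With the area it determines
  the word once it is known whether \<open>b \<le> m\<close>, hence one indicator for each
  case.\<close>

lemma card_shift_undefined:
  assumes "m \<ge> 0"
  shows "int (card {(a, b, c) \<in> words m (2 * m - s) j. a \<le> b \<and> c = b + m}) =
    (if even (j - m - s) \<and> 0 \<le> s \<and> 2 * s \<le> j - m - s \<and> j - m - s \<le> 2 * m then 1 else 0) +
    (if j - 2 * m - s > m \<and> 0 \<le> 3 * m + 2 * s - j \<and> 2 * m + 2 * s \<le> j \<and>
        2 * j \<le> 6 * m + 3 * s then 1 else 0)"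
proof -
  have 1: "{(a, b, c) \<in> words m (2 * m - s) j. a \<le> b \<and> c = b + m \<and> b \<le> m} =
    (if even (j - m - s) \<and> 0 \<le> s \<and> 2 * s \<le> j - m - s \<and> j - m - s \<le> 2 * m
     then {(s, (j - m - s) div 2, (j - m - s) div 2 + m)} else {})" (is "?L = ?R")
  proof (rule set_eqI)
    fix v show "v \<in> ?L \<longleftrightarrow> v \<in> ?R"
    proof (cases v)
      case (fields x y z)
      have "v \<in> ?L \<longleftrightarrow> x = s \<and> 2 * y = j - m - s \<and> 0 \<le> s \<and> s \<le> y \<and> y \<le> m \<and> z = y + m"
        using assms fields
        by (auto simp: words_def codeg_def gap_def min_def max_def)
      also have "\<dots> \<longleftrightarrow> v \<in> ?R"
      proof (cases "even (j - m - s)")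
        case True
        then obtain b where "j - m - s = 2 * b" by blast
        then show ?thesis using fields by auto
      next
        case False
        then have "2 * y \<noteq> j - m - s" by (metis dvd_triv_left)
        with False show ?thesis by simp
      qed
      finally show ?thesis .
    qed
  qed
  have 2: "{(a, b, c) \<in> words m (2 * m - s) j. a \<le> b \<and> c = b + m \<and> b > m} =
    (if j - 2 * m - s > m \<and> 0 \<le> 3 * m + 2 * s - j \<and> 2 * m + 2 * s \<le> j \<and> 2 * j \<le> 6 * m + 3 * s
     then {(3 * m + 2 * s - j, j - 2 * m - s, j - m - s)} else {})" (is "?L = ?R")
  proof (rule set_eqI)
    fix v show "v \<in> ?L \<longleftrightarrow> v \<in> ?R"
    proof (cases v)
      case (fields x y z)
      have "v \<in> ?L \<longleftrightarrow> x + y = m + s \<and> y = j - 2 * m - s \<and> 0 \<le> x \<and> x \<le> m \<and> m < y \<and> y \<le> x + m \<and> z = y + m"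
        using assms fields
        by (auto simp: words_def codeg_def gap_def min_def max_def)
      also have "\<dots> \<longleftrightarrow> v \<in> ?R"
        using fields by auto
      finally show ?thesis .
    qed
  qed
  have "{(a, b, c) \<in> words m (2 * m - s) j. a \<le> b \<and> c = b + m} =
    {(a, b, c) \<in> words m (2 * m - s) j. a \<le> b \<and> c = b + m \<and> b \<le> m} \<union>
    {(a, b, c) \<in> words m (2 * m - s) j. a \<le> b \<and> c = b + m \<and> b > m}" (is "_ = ?A \<union> ?B")
    by auto
  moreover have "card (?A \<union> ?B) = card ?A + card ?B"
    by (rule card_Un_disjoint) (auto intro: finite_subset[OF _ finite_words])
  ultimately show ?thesis unfolding 1 2 by simp
qed

section \<open>The closed formula and its recurrence\<close>

text \<open>Here \<open>6 * m - e - j\<close> is the dinv exponent \<open>k\<close>, and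
  \<open>(e + 1) div 2\<close> is half of \<open>e\<close> rounded up. The three cases are
  \<open>j + k\<close> above, at and below \<open>4 * m\<close>.\<close>

definition word_count :: "int \<Rightarrow> int \<Rightarrow> int \<Rightarrow> int" where
  "word_count m e j =
     (if e < 2 * m then
        max 0 (min (min (j - (e + 1) div 2 + 1) (e - (e + 1) div 2 + 1)) (6 * m - e - j - (e + 1) div 2 + 1))
      else if e = 2 * m then max 0 (min ((j - m + 2) div 2) ((3 * m - j + 2) div 2))
      else 0)"

text \<open>A trapezoid with rising side \<open>a\<close>, plateau \<open>c\<close> and falling side
  \<open>b\<close>. By the hypothesis \<open>a < c\<close> forces \<open>b > c\<close>, so the two
  sides are never active together and each yields its own indicator.\<close>

lemma clip_step:
  fixes a b c :: int
  assumes "a + b \<ge> 2 * c"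
  shows "max 0 (min (min (a + 1) c) (b - 1)) - max 0 (min (min a c) b) =
    (if 0 \<le> a \<and> a < c then 1 else 0) - (if 1 \<le> b \<and> b \<le> c then 1 else 0)"
  using assms by (simp add: min_def max_def)

text \<open>The right-hand side is that of \<open>words_step\<close> with the four families replaced
  by their sizes, so the formula obeys the recurrence of the count.\<close>

lemma word_count_step:
  assumes "m \<ge> 0" "e = 2 * m - s"
  shows "word_count m e (j + 1) - word_count m e j =
    (if (e + 1) div 2 \<le> j + 1 \<and> j + 1 \<le> e \<and> e \<le> 2 * m then 1 else 0) +
    (if s \<ge> 1 then max 0 ((j + 1 - s + 1 + m) div 2 - max (s + m + 1) (j + 1 - s + 1 - m) + 1) else 0) -
    (if s \<ge> 1 then max 0 (min m (j + 1 - 2 * s - m - 1) - max (s + 1) ((j + 1 - s - m + 1) div 2) + 1) else 0) -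
    ((if even (j - m - s) \<and> 0 \<le> s \<and> 2 * s \<le> j - m - s \<and> j - m - s \<le> 2 * m then 1 else 0) +
    (if j - 2 * m - s > m \<and> 0 \<le> 3 * m + 2 * s - j \<and> 2 * m + 2 * s \<le> j \<and>
        2 * j \<le> 6 * m + 3 * s then 1 else 0))"
proof -
  \<comment> \<open>The parities \<open>d\<close> of \<open>s\<close> and \<open>f\<close> of
    \<open>j - m - s\<close> are split off, so that every half becomes linear.\<close>
  obtain r d where r: "s = 2 * r + d" "d = 0 \<or> d = 1" by (metis oddE evenE add.right_neutral)
  obtain w f where w: "j = m + s + 2 * w + f" "f = 0 \<or> f = 1"
  proof -
    have "j = m + s + 2 * ((j - m - s) div 2) + (j - m - s) mod 2" by simp
    moreover have "(j - m - s) mod 2 = 0 \<or> (j - m - s) mod 2 = 1" by presburger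
    ultimately show ?thesis by (rule that)
  qed
  have divs: "(e + 1) div 2 = m - r"
    "(j + 1 - s + 1 + m) div 2 = w + 1 + m" "(j + 1 - s - m + 1) div 2 = w + 1"
    using r w assms by auto
  have ev: "even (j - m - s) \<longleftrightarrow> f = 0" using w by auto
  have j: "j + 1 - s + 1 - m = 2 * w + f + 2" "j + 1 - 2 * s - m - 1 = 2 * w + f - s"
    "j - m - s = 2 * w + f" "j - 2 * m - s = 2 * w + f - m"
    using w by auto
  show ?thesis
  proof (cases "s > 0")
    case True
    \<comment> \<open>The rising, falling and constant entries of \<open>word_count\<close> in the
      new coordinates.\<close>
    let ?A = "2 * w + f + s + r + 1" and ?B = "2 * m - 2 * w - f + r + 1" and ?C = "m - r - d + 1"
    have wc: "word_count m e j = max 0 (min (min ?A ?C) ?B)"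
      "word_count m e (j + 1) = max 0 (min (min (?A + 1) ?C) (?B - 1))"
      unfolding word_count_def divs using True r(1) w(1) assms(2) by simp_all
    have "?A + ?B \<ge> 2 * ?C" using r assms(1) True by auto
    then have step: "word_count m e (j + 1) - word_count m e j =
      (if 0 \<le> ?A \<and> ?A < ?C then 1 else 0) - (if 1 \<le> ?B \<and> ?B \<le> ?C then 1 else 0)"
      unfolding wc by (rule clip_step)
    \<comment> \<open>The words with \<open>x = 0\<close> account exactly for the rise; the other
      three families must produce the fall.\<close>
    have M1: "(e + 1) div 2 \<le> j + 1 \<and> j + 1 \<le> e \<and> e \<le> 2 * m \<longleftrightarrow> 0 \<le> ?A \<and> ?A < ?C"
      unfolding divs using True r(1) w(1) assms(2) by auto
    have U1: "even (j - m - s) \<and> 0 \<le> s \<and> 2 * s \<le> j - m - s \<and> j - m - s \<le> 2 * m \<longleftrightarrow>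
        f = 0 \<and> s \<le> w \<and> w \<le> m"
      unfolding ev using True w by auto
    have U2: "j - 2 * m - s > m \<and> 0 \<le> 3 * m + 2 * s - j \<and> 2 * m + 2 * s \<le> j \<and> 2 * j \<le> 6 * m + 3 * s
      \<longleftrightarrow> 2 * m < 2 * w + f \<and> m + s \<le> 2 * w + f \<and> 2 * w + f \<le> 2 * m + r"
      using True w(1) r by auto
    have B: "1 \<le> ?B \<and> ?B \<le> ?C \<longleftrightarrow> m + s \<le> 2 * w + f \<and> 2 * w + f \<le> 2 * m + r"
      using r by auto
    \<comment> \<open>Descents minus collisions minus undefined words with \<open>b \<le> m\<close>
      give the fall as far as \<open>2 * w + f \<le> 2 * m\<close>. The undefined words with
      \<open>b > m\<close> supply the rest, up to \<open>2 * m + r\<close>.\<close>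
    have main: "max 0 (w + 1 + m - max (s + m + 1) (2 * w + f + 2) + 1) -
        max 0 (min m (2 * w + f - s) - max (s + 1) (w + 1) + 1) -
        (if f = 0 \<and> s \<le> w \<and> w \<le> m then 1 else 0) =
      (if m + s \<le> 2 * w + f \<and> 2 * w + f \<le> 2 * m then -1 else (0::int))"
      using w(2)
    proof
      assume f: "f = 0"
      then show ?thesis using assms(1) True unfolding f
        by (cases "w \<ge> s"; cases "w \<le> m"; simp add: min_def max_def)
    next
      assume f: "f = 1"
      then show ?thesis using assms(1) True unfolding f
        by (cases "w \<ge> s"; cases "w \<le> m"; simp add: min_def max_def)
    qed
    have "r \<ge> 0" using True r by auto
    then have aux: "(if m + s \<le> 2 * w + f \<and> 2 * w + f \<le> 2 * m then -1 else (0::int)) -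
        (if 2 * m < 2 * w + f \<and> m + s \<le> 2 * w + f \<and> 2 * w + f \<le> 2 * m + r then 1 else 0) =
      - (if m + s \<le> 2 * w + f \<and> 2 * w + f \<le> 2 * m + r then 1 else 0)"
      by simp
    have regroup: "p + x - y - (u + v) = p + (x - y - u - v)" for p x y u v :: int by simp
    have s: "(1 \<le> s) = True" using True by simp
    show ?thesis unfolding step M1 U1 U2 B unfolding divs j s if_True regroup main aux
      by (rule diff_conv_add_uminus)
  next
    case False
    consider "s < 0" | "s = 0" using False by linarith
    then show ?thesis
    proof cases
      case 1
      then show ?thesis using assms unfolding word_count_def by auto
    next
      case 2
      then have "r = 0" "d = 0" using r by presburger+
      have divs2: "(j - m + 2) div 2 = w + 1" "(j + 1 - m + 2) div 2 = w + 1 + f"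
        "(3 * m - j + 2) div 2 = m - w + 1 - f" "(3 * m - (j + 1) + 2) div 2 = m - w"
        using w 2 by auto
      \<comment> \<open>Only the words with \<open>x = 0\<close> and the undefined words with
        \<open>b \<le> m\<close> survive here. The latter need \<open>j - m\<close> even, so the
        count changes at every second step, like the halves in the formula.\<close>
      show ?thesis using assms w \<open>r = 0\<close> 2 unfolding word_count_def divs divs2 ev
        by (auto simp: max_def min_def)
    qed
  qed
qed

text \<open>Both sides obey the same recurrence in \<open>j\<close>. At area \<open>-1\<close> there
  are no words and the formula vanishes, so no initial count has to be computed.\<close>

lemma card_words:
  assumes "m \<ge> 0" "j \<ge> -1"
  shows "int (card (words m e j)) = word_count m e j"
  using assms(2)
proof (induction j rule: int_ge_induct)
  case base
  have "words m e (-1) = {}" by (auto simp: words_def)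
  moreover have "word_count m e (-1) = 0" using assms(1) by (simp add: word_count_def max_def min_def; presburger)
  ultimately show ?case by simp
next
  case (step j)
  obtain s where s: "e = 2 * m - s" by (metis add_diff_cancel_left' diff_diff_eq2)
  show ?case
    using words_step[OF assms(1), of e j] word_count_step[OF assms(1) s, of j] step.IH
      card_initial_zero[OF assms(1), of e "j + 1"] card_descent_second[OF assms(1), of s "j + 1"]
      card_shift_collisions[OF assms(1), of s "j + 1"] card_shift_undefined[OF assms(1), of s j]
    unfolding s by linarith
qed

section \<open>From Dyck words to triples\<close>

lemma int_sc: "int (sc m p) = int m - gap (int m) p"
  by (auto simp: sc_def gap_def min_def)

lemma Cons_in_dyck_words4:
  "[0, a, b, c] \<in> dyck_words4 m \<longleftrightarrow> a \<le> m \<and> b \<le> a + m \<and> c \<le> b + m"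
proof -
  have "{1..3::nat} = {1, 2, 3}" by auto
  then show ?thesis by (simp add: dyck_words4_def)
qed

lemma dyck_words4_cases:
  assumes "g \<in> dyck_words4 m"
  obtains a b c where "g = [0, a, b, c]"
proof -
  from assms have "length g = 4" "g ! 0 = 0" by (auto simp: dyck_words4_def)
  with that show ?thesis by (auto simp: numeral_eq_Suc length_Suc_conv)
qed

text \<open>Each of the six pairs contributes \<open>m\<close> minus its gap. Against the leading
  letter the gaps are \<open>a\<close>, by \<open>a \<le> m\<close>, and \<open>min m b\<close>,
  \<open>min m c\<close>; their sum is the area minus the two corrections in
  \<open>codeg\<close>.\<close>

lemma int_dinv:
  assumes "[0, a, b, c] \<in> dyck_words4 m"
  shows "int (dinv m [0, a, b, c]) =
    6 * int m - int (area [0, a, b, c]) - codeg (int m) (int a) (int b) (int c)"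
proof -
  have set4: "{0..3::nat} = {0, 1, 2, 3}" "{0..<1::nat} = {0}" "{0..<2::nat} = {0, 1}"
    "{0..<3::nat} = {0, 1, 2}" by auto
  have "int (dinv m [0, a, b, c]) = int (sc m (- int a)) + int (sc m (- int b)) +
      int (sc m (- int c)) + int (sc m (int a - int b)) + int (sc m (int a - int c)) +
      int (sc m (int b - int c))"
    by (simp add: dinv_def set4 One_nat_def[symmetric] del: One_nat_def)
  moreover have "a \<le> m" using assms by (simp add: Cons_in_dyck_words4)
  ultimately show ?thesis
    by (simp add: int_sc area_def codeg_def) (simp add: gap_def min_def max_def)
qed

lemma cat4_coeff_eq_card:
  "cat4_coeff m j k = int (card {g \<in> dyck_words4 m. area g = j \<and> dinv m g = k})"
proof -
  have "cat4_coeff m j k =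
    (\<Sum>g\<in>dyck_words4 m. if area g = j \<and> dinv m g = k then 1 else 0)"
    unfolding cat4_coeff_def cat4_def coeff_sum by (intro sum.cong) auto
  also have "\<dots> = int (card {g \<in> dyck_words4 m. area g = j \<and> dinv m g = k})"
    by (simp add: sum.If_cases finite_dyck_words4 Int_def)
  finally show ?thesis .
qed

lemma card_dyck_words4:
  "card {g \<in> dyck_words4 m. area g = j \<and> dinv m g = k} =
     card (words (int m) (6 * int m - int j - int k) (int j))"
proof -
  let ?W = "words (int m) (6 * int m - int j - int k) (int j)"
  have "bij_betw (\<lambda>(a, b, c). [0, nat a, nat b, nat c]) ?W
    {g \<in> dyck_words4 m. area g = j \<and> dinv m g = k}"
  proof (rule bij_betw_byWitness[where f' = "\<lambda>g. (int (g ! 1), int (g ! 2), int (g ! 3))"])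
    show "(\<lambda>(a, b, c). [0, nat a, nat b, nat c]) ` ?W \<subseteq>
        {g \<in> dyck_words4 m. area g = j \<and> dinv m g = k}"
    proof clarsimp
      fix a b c assume W: "(a, b, c) \<in> ?W"
      then have D: "[0, nat a, nat b, nat c] \<in> dyck_words4 m"
        by (auto simp: words_def Cons_in_dyck_words4)
      have A: "area [0, nat a, nat b, nat c] = j"
        using W by (auto simp: words_def area_def)
      have "dinv m [0, nat a, nat b, nat c] = k"
        using int_dinv[OF D] W by (auto simp: words_def area_def)
      with D A show "[0, nat a, nat b, nat c] \<in> dyck_words4 m \<and>
          area [0, nat a, nat b, nat c] = j \<and> dinv m [0, nat a, nat b, nat c] = k"
        by blast
    qed
    show "(\<lambda>g. (int (g ! 1), int (g ! 2), int (g ! 3))) `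
        {g \<in> dyck_words4 m. area g = j \<and> dinv m g = k} \<subseteq> ?W"
    proof clarsimp
      fix g assume g: "g \<in> dyck_words4 m" and jk: "j = area g" "k = dinv m g"
      obtain a b c where abc: "g = [0, a, b, c]" using g by (rule dyck_words4_cases)
      show "(int (g ! Suc 0), int (g ! 2), int (g ! 3)) \<in>
          words (int m) (6 * int m - int (area g) - int (dinv m g)) (int (area g))"
        using g int_dinv[of a b c m] unfolding abc
        by (simp add: words_def Cons_in_dyck_words4 area_def)
    qed
  qed (auto simp: words_def elim!: dyck_words4_cases)
  then show ?thesis by (simp add: bij_betw_same_card)
qed

lemma cat4_coeff_eq_word_count:
  "cat4_coeff m j k = word_count (int m) (6 * int m - int j - int k) (int j)"
  using card_words[of "int m" "int j" "6 * int m - int j - int k"]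
  by (simp add: cat4_coeff_eq_card card_dyck_words4)

section \<open>Floors, symmetry and unimodality\<close>

lemma floor_pos_half: "floor_pos (real_of_int x / 2) = max (x div 2) 0"
  using floor_divide_of_int_eq[of x 2, where ?'a = real] by (simp add: floor_pos_def)

text \<open>Writing the last entry in terms of \<open>k\<close> exposes the symmetry in
  \<open>j\<close> and \<open>k\<close>.\<close>

lemma word_count_below:
  assumes "e < 2 * m" "e + j + k = 6 * m"
  shows "word_count m e j =
    max 0 (min (min (j - (e + 1) div 2 + 1) (e - (e + 1) div 2 + 1)) (k - (e + 1) div 2 + 1))"
proof -
  have k: "6 * m - e - j = k" using assms(2) by simp
  show ?thesis unfolding word_count_def k using assms(1) by (simp only: if_True)
qed

lemma word_count_middle:
  assumes "j + k = 4 * m"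
  shows "word_count m (2 * m) j = max 0 (min ((j - m + 2) div 2) ((k - m + 2) div 2))"
proof -
  have k: "3 * m - j + 2 = k - m + 2" using assms by simp
  show ?thesis unfolding word_count_def k by simp
qed

text \<open>The old minimum is at most its \<open>k\<close> entry, which lies below the entries of
  both \<open>k'\<close> and \<open>j'\<close>; any further entry depends on \<open>e\<close> and
  \<open>m\<close> alone.\<close>

lemma word_count_mono:
  assumes "e + j + k = 6 * m" "e + j' + k' = 6 * m" "k \<le> k'" "k' \<le> j'"
  shows "word_count m e j \<le> word_count m e j'"
proof -
  have mono: "max 0 (min (min a b) c) \<le> max 0 (min (min a' b) c')" if "c \<le> c'" "c' \<le> a'"
    for a b c a' c' :: int
    using that by auto
  consider "e < 2 * m" | "e = 2 * m" | "e > 2 * m" by linarith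
  then show ?thesis
  proof cases
    case 1
    show ?thesis
      unfolding word_count_below[OF 1 assms(1)] word_count_below[OF 1 assms(2)]
      using assms(3,4) by (intro mono) simp_all
  next
    case 2
    then have jk: "j + k = 4 * m" "j' + k' = 4 * m" using assms by auto
    have "(k - m + 2) div 2 \<le> (k' - m + 2) div 2" "(k' - m + 2) div 2 \<le> (j' - m + 2) div 2"
      using assms by (auto intro!: zdiv_mono1)
    then show ?thesis
      unfolding 2 word_count_middle[OF jk(1)] word_count_middle[OF jk(2)]
      by (intro max.mono min.boundedI) (auto simp: min.coboundedI2)
  qed (simp add: word_count_def)
qed

lemma word_count_sym:
  assumes "e + j + k = 6 * m"
  shows "word_count m e j = word_count m e k"
proof -
  have kj: "e + k + j = 6 * m" using assms by simp
  consider "e < 2 * m" | "e = 2 * m" | "e > 2 * m" by linarith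
  then show ?thesis
  proof cases
    case 1
    show ?thesis
      unfolding word_count_below[OF 1 assms] word_count_below[OF 1 kj] by (simp only: min.commute min.left_commute)
  next
    case 2
    then have jk: "j + k = 4 * m" "k + j = 4 * m" using assms by auto
    show ?thesis
      unfolding 2 word_count_middle[OF jk(1)] word_count_middle[OF jk(2)] by (simp only: min.commute)
  qed (simp add: word_count_def)
qed

lemma unimodal_cat4_coeff: "unimodal (map (\<lambda>i. cat4_coeff m (d - i) i) [0..<d + 1])"
proof -
  let ?xs = "map (\<lambda>i. cat4_coeff m (d - i) i) [0..<d + 1]"
  define e where "e = 6 * int m - int d"
  \<comment> \<open>Entry \<open>i\<close> has area \<open>d - i\<close>; symmetry lets
    \<open>i\<close> take its place.\<close>
  have nth: "?xs ! i = word_count (int m) e (int i)" if "i \<le> d" for i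
  proof -
    have "?xs ! i = word_count (int m) e (int (d - i))"
      using that by (simp add: cat4_coeff_eq_word_count e_def of_nat_diff del: upt_Suc)
    also have "\<dots> = word_count (int m) e (int i)"
      using that by (intro word_count_sym) (simp add: e_def of_nat_diff)
    finally show ?thesis .
  qed
  show ?thesis unfolding unimodal_def
  proof (intro exI[of _ "d div 2"] conjI allI impI)
    show "d div 2 < length ?xs" by simp
  next
    fix i j assume ij: "i \<le> j \<and> j \<le> d div 2"
    have "word_count (int m) e (int (d - i)) \<le> word_count (int m) e (int (d - j))"
      using ij by (intro word_count_mono[of _ _ "int i" _ _ "int j"]) (auto simp: e_def)
    moreover have "word_count (int m) e (int (d - l)) = word_count (int m) e (int l)" if "l \<le> d" for l
      using that by (intro word_count_sym) (simp add: e_def of_nat_diff)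
    moreover have "i \<le> d" "j \<le> d" using ij by auto
    ultimately show "?xs ! i \<le> ?xs ! j" by (simp only: nth)
  next
    fix i j assume ij: "d div 2 \<le> i \<and> i \<le> j \<and> j < length ?xs"
    show "?xs ! j \<le> ?xs ! i"
    proof (cases "i = j")
      case False
      have "word_count (int m) e (int j) \<le> word_count (int m) e (int i)"
      proof (cases "d \<le> 2 * i")
        case True
        then show ?thesis using ij
          by (intro word_count_mono[of _ _ "int (d - j)" _ _ "int (d - i)"]) (auto simp: e_def)
      next
        case odd: False
        \<comment> \<open>For odd \<open>d\<close> the peak index lies just left of the centre.
          Symmetry equates the two central entries, so the comparison can start from
          \<open>d - i = i + 1\<close>.\<close>
        then have d: "d = 2 * i + 1" using ij by presburger
        have "word_count (int m) e (int j) \<le> word_count (int m) e (int (d - i))"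
          using ij False d
          by (intro word_count_mono[of _ _ "int (d - j)" _ _ "int i"]) (auto simp: e_def)
        also have "\<dots> = word_count (int m) e (int i)"
          using d by (intro word_count_sym) (simp add: e_def)
        finally show ?thesis .
      qed
      then show ?thesis using ij nth[of i] nth[of j] by simp
    qed simp
  qed
qed

theorem theorem4p8:
  fixes m :: nat
  assumes "m \<ge> 1"
  shows
    "(\<forall>j k :: nat. j + k > 4 * m \<longrightarrow>
        cat4_coeff m j k =
          Min {floor_pos ((- 6 * real m + 2 + 3 * real j + real k) / 2),
               floor_pos ((6 * real m + 2 - real j - real k) / 2),
               floor_pos ((- 6 * real m + 2 + real j + 3 * real k) / 2)}) \<and>
     (\<forall>j k :: nat. j + k = 4 * m \<longrightarrow>
        cat4_coeff m j k =
          min (floor_pos ((- real m + 2 + real j) / 2))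
              (floor_pos ((- real m + 2 + real k) / 2))) \<and>
     (\<forall>j k :: nat. j + k < 4 * m \<longrightarrow> cat4_coeff m j k = 0) \<and>
     (\<forall>d :: nat. d > 0 \<longrightarrow> unimodal (map (\<lambda>i. cat4_coeff m (d - i) i) [0..<d + 1]))"
proof (intro conjI allI impI)
  fix j k :: nat
  assume jk: "j + k > 4 * m"
  have "floor_pos ((- 6 * real m + 2 + 3 * real j + real k) / 2) =
      max ((- 6 * int m + 2 + 3 * int j + int k) div 2) 0"
    "floor_pos ((6 * real m + 2 - real j - real k) / 2) =
      max ((6 * int m + 2 - int j - int k) div 2) 0"
    "floor_pos ((- 6 * real m + 2 + real j + 3 * real k) / 2) =
      max ((- 6 * int m + 2 + int j + 3 * int k) div 2) 0"
    by (simp_all flip: floor_pos_half)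
  moreover define e where "e = 6 * int m - int j - int k"
  \<comment> \<open>In terms of \<open>e\<close> the numerators are \<open>2 * j - e + 2\<close>,
    \<open>e + 2\<close> and \<open>2 * k - e + 2\<close>; rounding \<open>- e / 2\<close> down is
    rounding \<open>e / 2\<close> up.\<close>
  moreover have "(- 6 * int m + 2 + 3 * int j + int k) div 2 = int j - (e + 1) div 2 + 1"
    "(6 * int m + 2 - int j - int k) div 2 = e - (e + 1) div 2 + 1"
    "(- 6 * int m + 2 + int j + 3 * int k) div 2 = int k - (e + 1) div 2 + 1"
    unfolding e_def by presburger+
  moreover have "cat4_coeff m j k = word_count (int m) e (int j)"
    by (simp add: cat4_coeff_eq_word_count e_def)
  moreover have "e < 2 * int m" "e + int j + int k = 6 * int m" using jk by (simp_all add: e_def)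
  moreover have "Min {max a 0, max b 0, max c 0} = max 0 (min (min a b) c)" for a b c :: int
    by (auto simp: min_def max_def)
  ultimately show "cat4_coeff m j k =
      Min {floor_pos ((- 6 * real m + 2 + 3 * real j + real k) / 2),
           floor_pos ((6 * real m + 2 - real j - real k) / 2),
           floor_pos ((- 6 * real m + 2 + real j + 3 * real k) / 2)}"
    by (simp only: word_count_below)
next
  fix j k :: nat
  assume jk: "j + k = 4 * m"
  have "floor_pos ((- real m + 2 + real j) / 2) = max ((- int m + 2 + int j) div 2) 0"
    "floor_pos ((- real m + 2 + real k) / 2) = max ((- int m + 2 + int k) div 2) 0"
    by (simp_all flip: floor_pos_half)
  moreover have "cat4_coeff m j k =
      max 0 (min ((int j - int m + 2) div 2) ((int k - int m + 2) div 2))"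
  proof -
    have e: "6 * int m - int j - int k = 2 * int m" and "int j + int k = 4 * int m"
      using jk by auto
    then show ?thesis unfolding cat4_coeff_eq_word_count e by (intro word_count_middle)
  qed
  moreover have "min (max a 0) (max b 0) = max 0 (min a b)" for a b :: int
    by (auto simp: min_def max_def)
  moreover have "- int m + 2 + int j = int j - int m + 2" "- int m + 2 + int k = int k - int m + 2"
    by simp_all
  ultimately show "cat4_coeff m j k =
      min (floor_pos ((- real m + 2 + real j) / 2)) (floor_pos ((- real m + 2 + real k) / 2))"
    by (simp only:)
next
  fix j k :: nat
  assume "j + k < 4 * m"
  \<comment> \<open>The hypothesis means \<open>e > 2 * m\<close>, the zero case of
    \<open>word_count\<close>.\<close>
  then show "cat4_coeff m j k = 0" by (simp add: cat4_coeff_eq_word_count word_count_def)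
next
  fix d :: nat
  show "unimodal (map (\<lambda>i. cat4_coeff m (d - i) i) [0..<d + 1])"
    by (rule unimodal_cat4_coeff)
qed

end
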